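(* Let $F_1=F_2=1$ and $F_{m}=F_{m-1}+F_{m-2}$ be the Fibonacci numbers. For every $n\ge1$, the number $C_n^S$ of product-centered local triangles all of whose vertices lie in $S_n=\{i,j,k\}^n$ is $$C_n^S=(F_{n+2}-1)\,3^{n-1}.$$
   Context: $\Delta_n=\{i,j,k,e\}^n$ is the set of words $b=b_1b_2\cdots b_n$ of length $n$ in the four symbols $i,j,k,e$. Put $v(i)=(\cos 210^\circ,\sin 210^\circ)$, $v(j)=(\cos 90^\circ,\sin 90^\circ)$, $v(k)=(\cos 330^\circ,\sin 330^\circ)$, $v(e)=(0,0)$ in $\mathbb R^2$. Fix a real $d_1>0$ and put $d_r=d_1/2^{r-1}$. The centroid map $P:\Delta_n\to\mathbb R^2$ is $$P(b)=\sum_{r=1}^n \sigma_r(b)\,d_r\,v(b_r),\qquad \sigma_r(b)=(-1)^{\#\{s<r:\ b_s=e\}}.$$ $E_n$ is the set of unordered triples $\{b_1,b_2,b_3\}$ of distinct words in $\Delta_n$ such that $P(b_1),P(b_2),P(b_3)$ are the vertices of a nondegenerate equilateral triangle. For $b\in\Delta_n$ put $\mathrm{supp}(b)=\{r: b_r\ne e\}$. Let $\gamma$ be the permutation $i\mapsto j\mapsto k\mapsto i$, $e\mapsto e$. For nonempty $S\subseteq\mathrm{supp}(b)$, $\gamma_S(b)$ is obtained by applying $\gamma$ in the coordinates of $S$ and fixing the others, and $T(b,S)=\{b,\gamma_S(b),\gamma_S^2(b)\}$, which is always an element of $E_n$. The local triangles are the elements of $L_n=\{T(b,S): b\in\Delta_n,\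 \varnothing\ne S\subseteq\mathrm{supp}(b)\}\subseteq E_n$. Words are multiplied coordinatewise as quaternions ($e$ the identity, $i^2=j^2=k^2=-e$, $ij=k$, $jk=i$, $ki=j$, distinct elements of $\{i,j,k\}$ anticommute), with local signs collected into one global sign, giving an element of $\{\pm b:b\in\Delta_n\}$; let $u(\pm b)=b$ for $b\in\Delta_n$. Any two words commute or anticommute, so for $T=\{b_1,b_2,b_3\}\in E_n$ the word $p(T)=u(b_1b_2b_3)$ is well defined. Put $C_T=P(p(T))$ and $Q_T=\frac13(P(b_1)+P(b_2)+P(b_3))$. $T$ is product-centered if $C_T=Q_T$. *)

theory Defs
  imports "HOL-Analysis.Analysis" "HOL-Number_Theory.Fib"
begin

text \<open>Words are lists, and their positions are numbered from 0: position \<open>r\<close> here is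
  position \<open>r + 1\<close> of the usual notation \<open>b\<^sub>1 \<dots> b\<^sub>n\<close>.\<close>

datatype sym = Qi | Qj | Qk | Qe

definition words :: "nat \<Rightarrow> sym list set" where
  "words n = {b. length b = n}"

definition full_words :: "nat \<Rightarrow> sym list set" where
  "full_words n = {b. length b = n \<and> set b \<subseteq> {Qi, Qj, Qk}}"


subsection \<open>The centroid map\<close>

text \<open>The angles are 210, 90 and 330 degrees.\<close>

fun sym_vec :: "sym \<Rightarrow> real \<times> real" where
  "sym_vec Qi = (cos (7 * pi / 6), sin (7 * pi / 6))"
| "sym_vec Qj = (cos (pi / 2), sin (pi / 2))"
| "sym_vec Qk = (cos (11 * pi / 6), sin (11 * pi / 6))"
| "sym_vec Qe = (0, 0)"

definition orient :: "sym list \<Rightarrow> nat \<Rightarrow> real" where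
  "orient b r = (-1) ^ card {s. s < r \<and> b ! s = Qe}"

text \<open>The coefficient \<open>d\<^sub>1 / 2 ^ r\<close> is \<open>d\<^sub>r\<^sub>+\<^sub>1\<close>, because positions start at 0.\<close>

definition centroid :: "real \<Rightarrow> sym list \<Rightarrow> real \<times> real" where
  "centroid d1 b = (\<Sum>r<length b. (orient b r * (d1 / 2 ^ r)) *\<^sub>R sym_vec (b ! r))"


subsection \<open>Triangles\<close>

definition equilateral :: "'a::metric_space \<Rightarrow> 'a \<Rightarrow> 'a \<Rightarrow> bool" where
  "equilateral x y z \<longleftrightarrow> dist x y > 0 \<and> dist y z = dist x y \<and> dist z x = dist x y"

definition triangles :: "real \<Rightarrow> nat \<Rightarrow> sym list set set" where
  "triangles d1 n = {{b1, b2, b3} | b1 b2 b3.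
     {b1, b2, b3} \<subseteq> words n \<and> distinct [b1, b2, b3] \<and>
     equilateral (centroid d1 b1) (centroid d1 b2) (centroid d1 b3)}"

definition supp :: "sym list \<Rightarrow> nat set" where
  "supp b = {r. r < length b \<and> b ! r \<noteq> Qe}"

fun cyc :: "sym \<Rightarrow> sym" where
  "cyc Qi = Qj"
| "cyc Qj = Qk"
| "cyc Qk = Qi"
| "cyc Qe = Qe"

definition cyc_on :: "nat set \<Rightarrow> sym list \<Rightarrow> sym list" where
  "cyc_on S b = map (\<lambda>r. if r \<in> S then cyc (b ! r) else b ! r) [0..<length b]"

definition orbit_triangle :: "sym list \<Rightarrow> nat set \<Rightarrow> sym list set" where
  "orbit_triangle b S = {b, cyc_on S b, cyc_on S (cyc_on S b)}"

definition local_triangles :: "nat \<Rightarrow> sym list set set" where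
  "local_triangles n = {orbit_triangle b S | b S. b \<in> words n \<and> S \<noteq> {} \<and> S \<subseteq> supp b}"


subsection \<open>Quaternion products of words\<close>

text \<open>A signed symbol or word \<open>\<plusminus>b\<close> is a pair whose first component is \<open>1\<close> or \<open>-1\<close>.\<close>

fun sym_mult :: "sym \<Rightarrow> sym \<Rightarrow> int \<times> sym" where
  "sym_mult Qe y = (1, y)"
| "sym_mult x Qe = (1, x)"
| "sym_mult Qi Qi = (-1, Qe)"
| "sym_mult Qj Qj = (-1, Qe)"
| "sym_mult Qk Qk = (-1, Qe)"
| "sym_mult Qi Qj = (1, Qk)"
| "sym_mult Qj Qk = (1, Qi)"
| "sym_mult Qk Qi = (1, Qj)"
| "sym_mult Qj Qi = (-1, Qk)"
| "sym_mult Qk Qj = (-1, Qi)"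
| "sym_mult Qi Qk = (-1, Qj)"

fun word_mult :: "int \<times> sym list \<Rightarrow> int \<times> sym list \<Rightarrow> int \<times> sym list" where
  "word_mult (s, a) (t, b) =
     (s * t * prod_list (map2 (\<lambda>x y. fst (sym_mult x y)) a b),
      map2 (\<lambda>x y. snd (sym_mult x y)) a b)"

definition unsign :: "int \<times> sym list \<Rightarrow> sym list" where
  "unsign w = snd w"

definition tri_prod :: "sym list set \<Rightarrow> sym list" where
  "tri_prod T = (THE p. \<exists>b1 b2 b3. T = {b1, b2, b3} \<and> distinct [b1, b2, b3] \<and>
     p = unsign (word_mult (word_mult (1, b1) (1, b2)) (1, b3)))"

definition product_centered :: "real \<Rightarrow> sym list set \<Rightarrow> bool" where
  "product_centered d1 T \<longleftrightarrow>
     centroid d1 (tri_prod T) = (1 / 3) *\<^sub>R (\<Sum>b\<in>T. centroid d1 b)"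


subsection \<open>The product of a triangle does not depend on the order of its vertices\<close>

abbreviation (input) umult :: "sym list \<Rightarrow> sym list \<Rightarrow> sym list" where
  "umult a b \<equiv> map2 (\<lambda>x y. snd (sym_mult x y)) a b"

lemma unsign_mult3: "unsign (word_mult (word_mult (1, a) (1, b)) (1, c)) = umult (umult a b) c"
  by (simp add: unsign_def)

lemma umult_commute: "umult a b = umult b a"
proof -
  have "snd (sym_mult x y) = snd (sym_mult y x)" for x y
    by (cases x; cases y) auto
  then show ?thesis
    by (intro nth_equalityI) auto
qed

lemma umult_assoc: "umult (umult a b) c = umult a (umult b c)"
proof -
  have "snd (sym_mult (snd (sym_mult x y)) z) = snd (sym_mult x (snd (sym_mult y z)))" for x y z
    by (cases x; cases y; cases z) auto
  then show ?thesis
    by (intro nth_equalityI) auto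
qed

lemma set3_eq_perm:
  assumes "{b1, b2, b3} = {c1, c2, c3}" "distinct [c1, c2, c3]" "distinct [b1, b2, b3]"
  shows "(c1, c2, c3) \<in> {(b1, b2, b3), (b1, b3, b2), (b2, b1, b3), (b2, b3, b1),
      (b3, b1, b2), (b3, b2, b1)}"
proof -
  have "c1 \<in> {b1, b2, b3}" "c2 \<in> {b1, b2, b3}" "c3 \<in> {b1, b2, b3}"
    unfolding assms(1) by simp_all
  then show ?thesis using assms(2) by auto
qed

lemma comm_assoc_perm:
  assumes comm: "\<And>x y. f x y = f y x" and assoc: "\<And>x y z. f (f x y) z = f x (f y z)"
    and "(c1, c2, c3) \<in> {(b1, b2, b3), (b1, b3, b2), (b2, b1, b3), (b2, b3, b1),
      (b3, b1, b2), (b3, b2, b1)}"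
  shows "f (f c1 c2) c3 = f (f b1 b2) b3"
proof -
  have swap: "f (f x y) z = f (f x z) y" for x y z
    using assoc[of x y z] assoc[of x z y] comm[of y z] by simp
  have 1: "f (f b1 b3) b2 = f (f b1 b2) b3" "f (f b2 b1) b3 = f (f b1 b2) b3"
    using swap comm by metis+
  have 2: "f (f b2 b3) b1 = f (f b1 b2) b3" "f (f b3 b1) b2 = f (f b1 b2) b3"
    using swap[of b2 b3 b1] comm[of b1 b3] 1 by simp_all
  have 3: "f (f b3 b2) b1 = f (f b1 b2) b3"
    using comm[of b3 b2] 2 by simp
  show ?thesis using assms(3) 1 2 3 by fastforce
qed

lemma tri_prod_eq:
  assumes "distinct [b1, b2, b3]"
  shows "tri_prod {b1, b2, b3} = unsign (word_mult (word_mult (1, b1) (1, b2)) (1, b3))"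
  unfolding tri_prod_def
proof (rule the_equality)
  fix p
  assume "\<exists>c1 c2 c3. {b1, b2, b3} = {c1, c2, c3} \<and> distinct [c1, c2, c3] \<and>
    p = unsign (word_mult (word_mult (1, c1) (1, c2)) (1, c3))"
  then obtain c1 c2 c3 where T: "{b1, b2, b3} = {c1, c2, c3}" and d: "distinct [c1, c2, c3]"
    and p: "p = umult (umult c1 c2) c3"
    unfolding unsign_mult3 by blast
  have "(c1, c2, c3) \<in> {(b1, b2, b3), (b1, b3, b2), (b2, b1, b3), (b2, b3, b1),
      (b3, b1, b2), (b3, b2, b1)}"
    using T d assms by (rule set3_eq_perm)
  then have "umult (umult c1 c2) c3 = umult (umult b1 b2) b3"
    by (rule comm_assoc_perm[of umult, OF umult_commute umult_assoc])
  then have "p = umult (umult b1 b2) b3"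
    unfolding p .
  then show "p = unsign (word_mult (word_mult (1, b1) (1, b2)) (1, b3))"
    unfolding unsign_mult3 .
qed (use assms in blast)


subsection \<open>Local triangles are triangles\<close>

definition rot :: "real \<times> real \<Rightarrow> real \<times> real" where
  "rot z = (- fst z / 2 + sqrt 3 / 2 * snd z, - sqrt 3 / 2 * fst z - snd z / 2)"

lemma linear_rot: "linear rot"
  by (rule linearI) (simp_all add: rot_def prod_eq_iff distrib_left right_diff_distrib
      add_divide_distrib diff_divide_distrib)

lemma vec_values:
  "sym_vec Qi = (- sqrt 3 / 2, - 1 / 2)" "sym_vec Qj = (0, 1)" "sym_vec Qk = (sqrt 3 / 2, - 1 / 2)"
proof -
  have 1: "7 * pi / 6 = pi / 6 + pi" and 2: "11 * pi / 6 = - (pi / 6) + 2 * pi"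
    by auto
  show "sym_vec Qi = (- sqrt 3 / 2, - 1 / 2)" 
    unfolding sym_vec.simps 1 sin_periodic_pi cos_periodic_pi by (simp add: cos_30 sin_30)
  show "sym_vec Qj = (0, 1)" by simp
  show "sym_vec Qk = (sqrt 3 / 2, - 1 / 2)"
    unfolding sym_vec.simps 2 sin_periodic cos_periodic by (simp add: cos_30 sin_30)
qed

lemma vec_cyc: "sym_vec (cyc x) = rot (sym_vec x)"
  by (cases x) (simp_all add: vec_values rot_def del: sym_vec.simps(1-3))

lemma norm_vec: "x \<noteq> Qe \<Longrightarrow> norm (sym_vec x) = 1"
  by (cases x) (simp_all add: norm_Pair)

lemma equilateral_rot:
  assumes "z \<noteq> 0"
  shows "equilateral (a + z) (a + rot z) (a + rot (rot z))"
proof -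
  obtain x y where z: "z = (x, y)" by force
  define h :: real where "h = sqrt 3 / 2"
  have h: "h * h = 3 / 4" by (simp add: h_def)
  then have hh: "h * (h * t) = 3 / 4 * t" for t by (simp flip: mult.assoc)
  have r1: "rot z = (- x / 2 + h * y, - h * x - y / 2)"
    by (simp add: rot_def z h_def)
  have r2: "rot (rot z) = (- x / 2 - h * y, h * x - y / 2)"
  proof -
    have "rot (u, w) = (- u / 2 + h * w, - h * u - w / 2)" for u w
      by (simp add: rot_def h_def)
    moreover have "- (- x / 2 + h * y) / 2 + h * (- h * x - y / 2) = - x / 2 - h * y"
      and "- h * (- x / 2 + h * y) - (- h * x - y / 2) / 2 = h * x - y / 2"
      using hh[of x] hh[of y] by (simp_all add: field_split_simps right_diff_distrib distrib_left)
    ultimately show ?thesis by (simp only: r1)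
  qed
  have d1: "z - rot z = (3 / 2 * x - h * y, h * x + 3 / 2 * y)"
    unfolding r1 by (simp add: z)
  have d2: "rot z - rot (rot z) = (2 * (h * y), - 2 * (h * x))"
    unfolding r2 unfolding r1 by simp
  have d3: "rot (rot z) - z = (- 3 / 2 * x - h * y, h * x - 3 / 2 * y)"
    unfolding r2 by (simp add: z)
  have "(3 / 2 * x - h * y)\<^sup>2 + (h * x + 3 / 2 * y)\<^sup>2 = 3 * (x\<^sup>2 + y\<^sup>2)"
    by (simp add: power2_eq_square algebra_simps hh)
  moreover have "(2 * (h * y))\<^sup>2 + (- 2 * (h * x))\<^sup>2 = 3 * (x\<^sup>2 + y\<^sup>2)"
    by (simp add: power2_eq_square algebra_simps hh)
  moreover have "(- 3 / 2 * x - h * y)\<^sup>2 + (h * x - 3 / 2 * y)\<^sup>2 = 3 * (x\<^sup>2 + y\<^sup>2)"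
    by (simp add: power2_eq_square algebra_simps hh)
  ultimately have
    n: "norm (z - rot z) = sqrt (3 * (x\<^sup>2 + y\<^sup>2))"
       "norm (rot z - rot (rot z)) = sqrt (3 * (x\<^sup>2 + y\<^sup>2))"
       "norm (rot (rot z) - z) = sqrt (3 * (x\<^sup>2 + y\<^sup>2))"
    unfolding d1 d2 d3 norm_Pair real_norm_def power2_abs by simp_all
  have "x\<^sup>2 + y\<^sup>2 > 0"
    using assms z by (simp add: sum_power2_gt_zero_iff prod_eq_iff)
  then show ?thesis
    by (simp add: equilateral_def dist_norm n)
qed

lemma length_cyc_on [simp]: "length (cyc_on S b) = length b"
  by (simp add: cyc_on_def)

lemma nth_cyc_on: "r < length b \<Longrightarrow> cyc_on S b ! r = (if r \<in> S then cyc (b ! r) else b ! r)"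
  by (simp add: cyc_on_def)

lemma cyc_eq_Qe: "cyc x = Qe \<longleftrightarrow> x = Qe"
  by (cases x) simp_all

lemma orient_cyc_on:
  assumes "r < length b"
  shows "orient (cyc_on S b) r = orient b r"
proof -
  have "cyc_on S b ! s = Qe \<longleftrightarrow> b ! s = Qe" if "s < r" for s
    using that assms by (simp add: nth_cyc_on cyc_eq_Qe)
  then have "{s. s < r \<and> cyc_on S b ! s = Qe} = {s. s < r \<and> b ! s = Qe}"
    by blast
  then show ?thesis by (simp add: orient_def)
qed

definition partial_centroid :: "real \<Rightarrow> nat set \<Rightarrow> sym list \<Rightarrow> real \<times> real" where
  "partial_centroid d1 A b = (\<Sum>r\<in>A. (orient b r * (d1 / 2 ^ r)) *\<^sub>R sym_vec (b ! r))"

lemma centroid_split: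
  assumes "S \<subseteq> {..<length b}"
  shows "centroid d1 b = partial_centroid d1 ({..<length b} - S) b + partial_centroid d1 S b"
  unfolding centroid_def partial_centroid_def
  by (rule sum.subset_diff[OF assms finite_lessThan])

lemma centroid_cyc_on:
  assumes "S \<subseteq> {..<length b}"
  shows "partial_centroid d1 ({..<length b} - S) (cyc_on S b)
           = partial_centroid d1 ({..<length b} - S) b"
    and "partial_centroid d1 S (cyc_on S b) = rot (partial_centroid d1 S b)"
proof -
  show "partial_centroid d1 ({..<length b} - S) (cyc_on S b)
      = partial_centroid d1 ({..<length b} - S) b"
    unfolding partial_centroid_def
    by (rule sum.cong) (auto simp: nth_cyc_on orient_cyc_on)
  have "partial_centroid d1 S (cyc_on S b)
      = (\<Sum>r\<in>S. rot ((orient b r * (d1 / 2 ^ r)) *\<^sub>R sym_vec (b ! r)))"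
    unfolding partial_centroid_def
  proof (rule sum.cong)
    fix r assume "r \<in> S"
    then show "(orient (cyc_on S b) r * (d1 / 2 ^ r)) *\<^sub>R sym_vec (cyc_on S b ! r)
        = rot ((orient b r * (d1 / 2 ^ r)) *\<^sub>R sym_vec (b ! r))"
      using assms by (auto simp: nth_cyc_on orient_cyc_on vec_cyc linear_scale[OF linear_rot])
  qed simp
  then show "partial_centroid d1 S (cyc_on S b) = rot (partial_centroid d1 S b)"
    by (simp add: partial_centroid_def linear_sum[OF linear_rot])
qed

lemma dyadic_tail: "m \<le> n \<Longrightarrow> (\<Sum>r\<in>{m..<n}. 1 / 2 ^ r) = 2 / 2 ^ m - 2 / (2::real) ^ n"
  by (induction n rule: dec_induct) (simp_all add: sum.atLeastLessThan_Suc)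

lemma partial_centroid_nonzero:
  assumes "d1 > 0" "S \<noteq> {}" "S \<subseteq> supp b"
  shows "partial_centroid d1 S b \<noteq> 0"
proof -
  define n where "n = length b"
  define f where "f r = (orient b r * (d1 / 2 ^ r)) *\<^sub>R sym_vec (b ! r)" for r
  have fin: "finite S"
    by (rule finite_subset[OF assms(3)]) (simp add: supp_def)
  define m where "m = Min S"
  have m: "m \<in> S" "m < n" and min: "\<And>r. r \<in> S \<Longrightarrow> m \<le> r"
  proof -
    show "m \<in> S" unfolding m_def using fin assms(2) by (rule Min_in)
    then show "m < n" using assms(3) by (auto simp: n_def supp_def)
    show "\<And>r. r \<in> S \<Longrightarrow> m \<le> r" unfolding m_def using fin by (rule Min_le)
  qed
  have nf: "norm (f r) = d1 / 2 ^ r" if "r \<in> S" for r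
  proof -
    have "b ! r \<noteq> Qe" using that assms(3) by (auto simp: supp_def)
    moreover have "\<bar>orient b r\<bar> = 1" by (simp add: orient_def)
    ultimately show ?thesis using assms(1) by (simp add: f_def norm_vec abs_mult)
  qed
  have "norm (sum f (S - {m})) \<le> (\<Sum>r\<in>S - {m}. d1 / 2 ^ r)"
    by (rule sum_norm_le) (auto simp: nf)
  also have "\<dots> \<le> (\<Sum>r\<in>{Suc m..<n}. d1 / 2 ^ r)"
  proof (rule sum_mono2)
    show "S - {m} \<subseteq> {Suc m..<n}"
    proof
      fix r assume r: "r \<in> S - {m}"
      then have "m \<le> r" "r \<noteq> m" using min by auto
      moreover have "r < n" using r assms(3) by (auto simp: n_def supp_def)
      ultimately show "r \<in> {Suc m..<n}" by simp
    qed
  qed (use assms in auto)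
  also have "\<dots> = d1 * (\<Sum>r\<in>{Suc m..<n}. 1 / 2 ^ r)"
    by (simp add: sum_distrib_left)
  also have "\<dots> = d1 * (1 / 2 ^ m - 2 / 2 ^ n)"
    using m by (subst dyadic_tail) auto
  also have "\<dots> < d1 * (1 / 2 ^ m)"
    using assms(1) by (intro mult_strict_left_mono) auto
  also have "\<dots> = d1 / 2 ^ m"
    by simp
  finally have "norm (sum f (S - {m})) < norm (f m)"
    by (simp add: nf m)
  moreover have "partial_centroid d1 S b = f m + sum f (S - {m})"
    unfolding partial_centroid_def f_def[symmetric] by (rule sum.remove[OF fin m(1)])
  ultimately show ?thesis
    using norm_minus_cancel[of "f m"] by (auto simp: add_eq_0_iff)
qed

lemma local_triangles_subset:
  assumes "d1 > 0"
  shows "local_triangles n \<subseteq> triangles d1 n"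
proof
  fix T assume "T \<in> local_triangles n"
  then obtain b S where T: "T = {b, cyc_on S b, cyc_on S (cyc_on S b)}"
    and b: "length b = n" and S: "S \<noteq> {}" "S \<subseteq> supp b"
    by (auto simp: local_triangles_def orbit_triangle_def words_def)
  have S': "S \<subseteq> {..<length b}" using S by (auto simp: supp_def)
  have S'': "S \<subseteq> {..<length (cyc_on S b)}" "S \<subseteq> {..<length (cyc_on S (cyc_on S b))}"
    using S' by auto
  have eq: "equilateral (centroid d1 b) (centroid d1 (cyc_on S b))
      (centroid d1 (cyc_on S (cyc_on S b)))"
    using equilateral_rot[OF partial_centroid_nonzero[OF assms S]]
      centroid_split[OF S'] centroid_split[OF S''(1)] centroid_split[OF S''(2)]
      centroid_cyc_on[OF S'] centroid_cyc_on[OF S''(1)] by simp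
  then have "distinct [b, cyc_on S b, cyc_on S (cyc_on S b)]"
    by (auto simp: equilateral_def)
  with eq b show "T \<in> triangles d1 n"
    unfolding triangles_def T words_def
    by (intro CollectI exI[of _ b] exI[of _ "cyc_on S b"] exI[of _ "cyc_on S (cyc_on S b)"]) auto
qed

end

theory Submission
  imports Defs
begin

text \<open>
  Fix a word \<open>b\<close> and a nonempty set \<open>S\<close> of positions in its support, and let \<open>T\<close> be the local
  triangle that they generate. At a position of \<open>S\<close> the three vertices show \<open>i\<close>, \<open>j\<close> and \<open>k\<close>,
  whose product is \<open>e\<close> up to sign and whose vectors add up to zero; at any other position they all
  show the same symbol \<open>x\<close>, and \<open>x\<^sup>3\<close> is \<open>x\<close> up to sign. Hence the product word is \<open>b\<close> with \<open>S\<close>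
  overwritten by \<open>e\<close>, while the barycentre is the part of the centroid of \<open>b\<close> that comes from
  outside \<open>S\<close>. The two points are the same sum over the positions outside \<open>S\<close>, except that each new
  letter \<open>e\<close> flips the sign of every later term. Their difference is twice the part of the centroid
  on the positions of the support that lie outside \<open>S\<close> and have an odd number of elements of \<open>S\<close>
  before them. The coefficients halve from each position to the next, so such a part vanishes only
  if there are no such positions (lemma \<open>product_centered_orbit_iff\<close>).

  If \<open>b\<close> has no letter \<open>e\<close>, the criterion depends on \<open>S\<close> only, and the count is a product. Deciding
  membership of the last position shows that the admissible sets are counted by Fibonacci numbers
  (lemma \<open>card_evenly_preceded\<close>); the empty one is discarded. For each admissible \<open>S\<close> the
  triangles are the orbits of a free action of the cyclic group of order three on the
  \<open>3\<^sup>n\<close> words, so there are \<open>3\<^sup>n\<^sup>-\<^sup>1\<close> of them (lemma \<open>card_orbit_triangles\<close>). A triangle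
  determines \<open>S\<close> as the set of positions at which its vertices differ, so nothing is counted twice.
\<close>

section \<open>The cyclic action on words\<close>

lemma cyc_cyc_cyc: "cyc (cyc (cyc x)) = x"
  by (cases x) simp_all

lemma cyc_neq: "x \<noteq> Qe \<Longrightarrow> cyc x \<noteq> x"
  by (cases x) simp_all

lemma cyc_on_cyc_on_cyc_on: "cyc_on S (cyc_on S (cyc_on S b)) = b"
  by (rule nth_equalityI) (simp_all add: nth_cyc_on cyc_cyc_cyc)

lemma cyc_on_neq:
  assumes "S \<noteq> {}" "S \<subseteq> supp b"
  shows "cyc_on S b \<noteq> b"
proof -
  obtain r where "r \<in> S" "r < length b" "b ! r \<noteq> Qe"
    using assms by (auto simp: supp_def)
  then show ?thesis
    using nth_cyc_on[of r b S] cyc_neq[of "b ! r"] by auto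
qed

lemma supp_cyc_on: "supp (cyc_on S b) = supp b"
  by (auto simp: supp_def nth_cyc_on cyc_eq_Qe split: if_splits)

lemma distinct_orbit:
  assumes "S \<noteq> {}" "S \<subseteq> supp b"
  shows "distinct [b, cyc_on S b, cyc_on S (cyc_on S b)]"
proof -
  have "cyc_on S (cyc_on S (cyc_on S b)) \<noteq> cyc_on S (cyc_on S b)"
    by (rule cyc_on_neq) (use assms in \<open>simp_all add: supp_cyc_on\<close>)
  moreover have "cyc_on S (cyc_on S b) \<noteq> cyc_on S b"
    by (rule cyc_on_neq) (use assms in \<open>simp_all add: supp_cyc_on\<close>)
  moreover have "cyc_on S b \<noteq> b"
    by (rule cyc_on_neq[OF assms])
  ultimately show ?thesis
    by (auto simp: cyc_on_cyc_on_cyc_on)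
qed

lemma full_words_eq_supp: "b \<in> full_words n \<longleftrightarrow> length b = n \<and> supp b = {..<n}"
proof -
  have "x \<in> {Qi, Qj, Qk} \<longleftrightarrow> x \<noteq> Qe" for x
    by (cases x) simp_all
  then have "set b \<subseteq> {Qi, Qj, Qk} \<longleftrightarrow> Qe \<notin> set b"
    by blast
  then show ?thesis
    by (auto simp: full_words_def supp_def in_set_conv_nth)
qed

lemma cyc_on_full_words_iff: "cyc_on S b \<in> full_words n \<longleftrightarrow> b \<in> full_words n"
  by (simp add: full_words_eq_supp supp_cyc_on)

section \<open>Product word and barycentre\<close>

definition erase :: "nat set \<Rightarrow> sym list \<Rightarrow> sym list" where
  "erase S b = map (\<lambda>r. if r \<in> S then Qe else b ! r) [0..<length b]"

lemma length_erase [simp]: "length (erase S b) = length b"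
  by (simp add: erase_def)

lemma nth_erase: "r < length b \<Longrightarrow> erase S b ! r = (if r \<in> S then Qe else b ! r)"
  by (simp add: erase_def)

lemma tri_prod_orbit:
  assumes "S \<noteq> {}" "S \<subseteq> supp b"
  shows "tri_prod (orbit_triangle b S) = erase S b"
proof -
  have moved: "snd (sym_mult (snd (sym_mult x (cyc x))) (cyc (cyc x))) = Qe" for x
    by (cases x) simp_all
  have kept: "snd (sym_mult (snd (sym_mult x x)) x) = x" for x
    by (cases x) simp_all
  have "umult (umult b (cyc_on S b)) (cyc_on S (cyc_on S b)) = erase S b"
    by (rule nth_equalityI) (auto simp: nth_cyc_on nth_erase moved kept)
  then show ?thesis
    unfolding orbit_triangle_def tri_prod_eq[OF distinct_orbit[OF assms]] unsign_mult3 .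
qed

text \<open>The full turn \<open>1 + rot + rot\<^sup>2\<close> is zero, so the rotating part of the three centroids cancels
  and only the part outside \<open>S\<close>, common to the three vertices, survives in the mean.\<close>

lemma barycentre_orbit:
  assumes "S \<noteq> {}" "S \<subseteq> supp b"
  shows "(1 / 3) *\<^sub>R (\<Sum>c\<in>orbit_triangle b S. centroid d1 c)
       = partial_centroid d1 ({..<length b} - S) b"
proof -
  define w where "w = partial_centroid d1 ({..<length b} - S) b"
  define z where "z = partial_centroid d1 S b"
  have S: "S \<subseteq> {..<length b}"
    using assms(2) by (auto simp: supp_def)
  have S1: "S \<subseteq> {..<length (cyc_on S b)}" and S2: "S \<subseteq> {..<length (cyc_on S (cyc_on S b))}"
    using S by simp_all
  have c: "centroid d1 b = w + z" "centroid d1 (cyc_on S b) = w + rot z"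
    "centroid d1 (cyc_on S (cyc_on S b)) = w + rot (rot z)"
    using centroid_split[OF S] centroid_split[OF S1] centroid_split[OF S2]
      centroid_cyc_on[OF S] centroid_cyc_on[OF S1] by (simp_all add: w_def z_def)
  have sqrt3: "sqrt 3 * (sqrt 3 * t) = 3 * t" for t
    by (simp flip: mult.assoc)
  have turn: "z + rot z + rot (rot z) = 0"
    by (simp add: rot_def prod_eq_iff algebra_simps add_divide_distrib diff_divide_distrib sqrt3)
  have "(\<Sum>c\<in>orbit_triangle b S. centroid d1 c)
      = centroid d1 b + centroid d1 (cyc_on S b) + centroid d1 (cyc_on S (cyc_on S b))"
    using distinct_orbit[OF assms] by (simp add: orbit_triangle_def add.assoc)
  also have "\<dots> = 3 *\<^sub>R w + (z + rot z + rot (rot z))"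
    by (simp add: c prod_eq_iff)
  finally show ?thesis
    by (simp add: turn w_def)
qed

lemma orient_erase:
  assumes "r < length b" "S \<subseteq> supp b"
  shows "orient (erase S b) r = orient b r * (-1) ^ card (S \<inter> {..<r})"
proof -
  have "{s. s < r \<and> erase S b ! s = Qe} = {s. s < r \<and> b ! s = Qe} \<union> (S \<inter> {..<r})"
    using assms(1) by (auto simp: nth_erase split: if_splits)
  moreover have "{s. s < r \<and> b ! s = Qe} \<inter> (S \<inter> {..<r}) = {}"
    using assms(2) by (auto simp: supp_def)
  ultimately show ?thesis
    by (simp add: orient_def card_Un_disjoint power_add)
qed

text \<open>Each erased position flips all later signs. The terms outside \<open>S\<close> with an even number of
  flips cancel in the difference, and those with an odd number are doubled.\<close>

lemma centroid_erase:
  assumes "S \<subseteq> supp b"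
  shows "partial_centroid d1 ({..<length b} - S) b - centroid d1 (erase S b)
       = 2 *\<^sub>R partial_centroid d1 {r \<in> supp b - S. odd (card (S \<inter> {..<r}))} b"
    (is "_ = 2 *\<^sub>R partial_centroid d1 ?B b")
proof -
  let ?f = "\<lambda>r. (orient b r * (d1 / 2 ^ r)) *\<^sub>R sym_vec (b ! r)"
  let ?g = "\<lambda>r. (orient (erase S b) r * (d1 / 2 ^ r)) *\<^sub>R sym_vec (erase S b ! r)"
  have S: "S \<subseteq> {..<length b}"
    using assms by (auto simp: supp_def)
  have "sum ?g {..<length b} = sum ?g ({..<length b} - S)"
    using S by (intro sum.mono_neutral_right) (auto simp: nth_erase zero_prod_def)
  then have "partial_centroid d1 ({..<length b} - S) b - centroid d1 (erase S b)
      = (\<Sum>r\<in>{..<length b} - S. ?f r - ?g r)"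
    by (simp add: partial_centroid_def centroid_def sum_subtractf)
  also have "\<dots> = (\<Sum>r\<in>?B. 2 *\<^sub>R ?f r)"
  proof (rule sum.mono_neutral_cong_right)
    show "\<forall>r\<in>{..<length b} - S - ?B. ?f r - ?g r = 0"
      using assms by (auto simp: supp_def nth_erase orient_erase zero_prod_def)
    show "?f r - ?g r = 2 *\<^sub>R ?f r" if "r \<in> ?B" for r
      using that assms by (auto simp: supp_def nth_erase orient_erase simp flip: scaleR_add_left)
  qed (auto simp: supp_def)
  finally show ?thesis
    by (simp add: partial_centroid_def scaleR_sum_right)
qed

text \<open>A part of a centroid on a nonempty set of support positions is dominated by its first term,
  hence nonzero; this makes the sign condition necessary as well as sufficient.\<close>

lemma product_centered_orbit_iff:
  assumes "d1 > 0" "S \<noteq> {}" "S \<subseteq> supp b"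
  shows "product_centered d1 (orbit_triangle b S)
     \<longleftrightarrow> (\<forall>r\<in>supp b - S. even (card (S \<inter> {..<r})))"
proof -
  let ?B = "{r \<in> supp b - S. odd (card (S \<inter> {..<r}))}"
  have "product_centered d1 (orbit_triangle b S)
      \<longleftrightarrow> partial_centroid d1 ({..<length b} - S) b - centroid d1 (erase S b) = 0"
    unfolding product_centered_def tri_prod_orbit[OF assms(2,3)] barycentre_orbit[OF assms(2,3)]
    by auto
  also have "\<dots> \<longleftrightarrow> partial_centroid d1 ?B b = 0"
    unfolding centroid_erase[OF assms(3)] by simp
  also have "\<dots> \<longleftrightarrow> ?B = {}"
  proof
    show "?B = {}" if "partial_centroid d1 ?B b = 0"
      using partial_centroid_nonzero[OF assms(1), of ?B b] that by blast
    show "partial_centroid d1 ?B b = 0" if "?B = {}"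
      unfolding that by (simp add: partial_centroid_def)
  qed
  finally show ?thesis
    by auto
qed

section \<open>Counting the admissible sets of positions\<close>

text \<open>As 0-1 strings of length \<open>n\<close>, these are the concatenations of blocks \<open>0\<close> and \<open>11\<close>,
  possibly followed by a single final \<open>1\<close>.\<close>

definition evenly_preceded :: "nat \<Rightarrow> nat set set" where
  "evenly_preceded n = {S. S \<subseteq> {..<n} \<and> (\<forall>r<n. r \<notin> S \<longrightarrow> even (card (S \<inter> {..<r})))}"

lemma finite_evenly_preceded: "finite (evenly_preceded n)"
  by (rule finite_subset[of _ "Pow {..<n}"]) (auto simp: evenly_preceded_def)

lemma evenly_preceded_below: "S \<in> evenly_preceded n \<Longrightarrow> n \<notin> S \<and> finite S"
  by (auto simp: evenly_preceded_def intro: finite_subset)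

lemma evenly_preceded_Suc_insert:
  assumes "n \<notin> S"
  shows "insert n S \<in> evenly_preceded (Suc n) \<longleftrightarrow> S \<in> evenly_preceded n"
proof -
  have "insert n S \<inter> {..<r} = S \<inter> {..<r}" if "r < n" for r
    using that by auto
  moreover have "insert n S \<subseteq> {..<Suc n} \<longleftrightarrow> S \<subseteq> {..<n}"
    using assms by (auto simp: less_Suc_eq)
  ultimately show ?thesis
    by (auto simp: evenly_preceded_def less_Suc_eq)
qed

lemma evenly_preceded_Suc_keep:
  assumes "n \<notin> S"
  shows "S \<in> evenly_preceded (Suc n) \<longleftrightarrow> S \<in> evenly_preceded n \<and> even (card S)"
proof -
  have "S \<inter> {..<n} = S" if "S \<subseteq> {..<n}"
    using that by blast
  moreover have "S \<subseteq> {..<Suc n} \<longleftrightarrow> S \<subseteq> {..<n}"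
    using assms by (auto simp: less_Suc_eq)
  ultimately show ?thesis
    using assms by (auto simp: evenly_preceded_def less_Suc_eq)
qed

lemma evenly_preceded_Suc:
  "evenly_preceded (Suc n)
     = {S \<in> evenly_preceded n. even (card S)} \<union> insert n ` evenly_preceded n"
proof (intro set_eqI)
  fix S
  show "S \<in> evenly_preceded (Suc n) \<longleftrightarrow>
      S \<in> {S \<in> evenly_preceded n. even (card S)} \<union> insert n ` evenly_preceded n"
  proof (cases "n \<in> S")
    case True
    then have S: "S = insert n (S - {n})"
      by blast
    have "S \<in> insert n ` evenly_preceded n \<longleftrightarrow> S - {n} \<in> evenly_preceded n"
    proof
      assume "S \<in> insert n ` evenly_preceded n"
      then show "S - {n} \<in> evenly_preceded n"
        using evenly_preceded_below by fastforce
    qed (use S in blast)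
    moreover have "S \<in> evenly_preceded (Suc n) \<longleftrightarrow> S - {n} \<in> evenly_preceded n"
      using evenly_preceded_Suc_insert[of n "S - {n}"] S by simp
    ultimately show ?thesis
      using True evenly_preceded_below by blast
  next
    case False
    then show ?thesis
      using evenly_preceded_Suc_keep by blast
  qed
qed

text \<open>The parity of the set decides whether the next position may be left out, so the recursion has
  to follow the two parities separately; this turns it into the Fibonacci recursion.\<close>

lemma card_evenly_preceded_parity:
  "card {S \<in> evenly_preceded n. even (card S)} = fib (Suc n) \<and>
   card {S \<in> evenly_preceded n. odd (card S)} = fib n"
proof (induction n)
  case 0
  have "{S \<in> evenly_preceded 0. even (card S)} = {{}}"
    and "{S \<in> evenly_preceded 0. odd (card S)} = {}"
    by (auto simp: evenly_preceded_def)
  then show ?case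
    by (simp only:) simp
next
  case (Suc n)
  define E where "E = {S \<in> evenly_preceded n. even (card S)}"
  define D where "D = {S \<in> evenly_preceded n. odd (card S)}"
  have fin: "finite E" "finite D"
    using finite_evenly_preceded by (simp_all add: E_def D_def)
  have notin: "n \<notin> S" if "S \<in> E \<union> D" for S
    using that evenly_preceded_below by (auto simp: E_def D_def)
  have card_insert: "card (insert n S) = Suc (card S)" if "S \<in> evenly_preceded n" for S
    using evenly_preceded_below[OF that] by simp
  have "{S \<in> evenly_preceded (Suc n). even (card S)} = E \<union> insert n ` D"
    by (auto simp: evenly_preceded_Suc E_def D_def card_insert)
  moreover have "{S \<in> evenly_preceded (Suc n). odd (card S)} = insert n ` E"
    by (auto simp: evenly_preceded_Suc E_def D_def card_insert)
  moreover have "inj_on (insert n) (E \<union> D)"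
    using notin by (intro inj_onI) (metis Diff_insert_absorb)
  then have "card (insert n ` D) = card D" "card (insert n ` E) = card E"
    by (auto intro!: card_image intro: inj_on_subset)
  moreover have "E \<inter> insert n ` D = {}"
    using notin by blast
  ultimately show ?case
    using Suc fin by (simp add: card_Un_disjoint E_def[symmetric] D_def[symmetric])
qed

lemma card_evenly_preceded: "card (evenly_preceded n) = fib (n + 2)"
proof -
  have "evenly_preceded n = {S \<in> evenly_preceded n. even (card S)} \<union>
      {S \<in> evenly_preceded n. odd (card S)}" (is "_ = ?E \<union> ?D")
    by blast
  then have "card (evenly_preceded n) = card (?E \<union> ?D)"
    by simp
  also have "\<dots> = card ?E + card ?D"
    by (rule card_Un_disjoint) (auto simp: finite_evenly_preceded)
  finally show ?thesis
    using card_evenly_preceded_parity[of n] by simp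
qed

section \<open>Counting the triangles\<close>

lemma card_full_words: "card (full_words n) = 3 ^ n"
  using card_lists_length_eq[of "{Qi, Qj, Qk}" n]
  by (simp add: full_words_def conj_commute numeral_3_eq_3)

lemma orbit_triangle_eq:
  assumes "c \<in> orbit_triangle b S"
  shows "orbit_triangle c S = orbit_triangle b S"
  using assms unfolding orbit_triangle_def by (auto simp: cyc_on_cyc_on_cyc_on)

lemma orbit_triangle_full_words_iff: "orbit_triangle b S \<subseteq> full_words n \<longleftrightarrow> b \<in> full_words n"
  by (simp add: orbit_triangle_def cyc_on_full_words_iff)

text \<open>A triangle is generated by each of its three vertices, so for fixed \<open>S\<close> the triangles cut the
  \<open>3\<^sup>n\<close> words into disjoint blocks of three.\<close>

lemma card_orbit_triangles:
  assumes "S \<noteq> {}" "S \<subseteq> {..<n}"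
  shows "card ((\<lambda>b. orbit_triangle b S) ` full_words n) = 3 ^ (n - 1)"
proof -
  let ?C = "(\<lambda>b. orbit_triangle b S) ` full_words n"
  have fin: "finite (full_words n)"
    using card_full_words[of n] by (intro card_ge_0_finite) simp
  have union: "\<Union>?C = full_words n"
  proof
    show "\<Union>?C \<subseteq> full_words n"
      using orbit_triangle_full_words_iff by blast
    show "full_words n \<subseteq> \<Union>?C"
      by (auto simp: orbit_triangle_def)
  qed
  have "3 * card ?C = card (\<Union>?C)"
  proof (rule card_partition)
    show "finite ?C" "finite (\<Union>?C)"
      using fin by (simp_all only: union finite_imageI)
    show "card T = 3" if C: "T \<in> ?C" for T
    proof -
      obtain b where "b \<in> full_words n" and T: "T = orbit_triangle b S"
        using C by blast
      then have "S \<subseteq> supp b"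
        using assms(2) by (simp add: full_words_eq_supp)
      from distinct_orbit[OF assms(1) this] show ?thesis
        by (simp add: T orbit_triangle_def)
    qed
    show "T \<inter> U = {}" if "T \<in> ?C" "U \<in> ?C" "T \<noteq> U" for T U
      using that orbit_triangle_eq by blast
  qed
  then have "3 * card ?C = 3 ^ n"
    by (simp only: union card_full_words)
  moreover have "n = Suc (n - 1)"
    using assms by (cases n) auto
  then have "(3::nat) ^ n = 3 * 3 ^ (n - 1)"
    by (metis power_Suc)
  ultimately show ?thesis
    by simp
qed

text \<open>Moved letters differ between any two vertices and all others are shared, so \<open>S\<close> can be read
  off without knowing which vertex the triangle was generated from. This keeps the families of
  triangles for different \<open>S\<close> apart.\<close>

lemma moved_positions_orbit:
  assumes "S \<subseteq> supp b"
  shows "S = {r. r < length b \<and> (\<exists>x\<in>orbit_triangle b S. \<exists>y\<in>orbit_triangle b S. x ! r \<noteq> y ! r)}"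
    (is "S = ?M")
proof
  show "S \<subseteq> ?M"
  proof
    fix r assume "r \<in> S"
    moreover from this have "r < length b" "b ! r \<noteq> Qe"
      using assms by (auto simp: supp_def)
    ultimately have "cyc_on S b ! r \<noteq> b ! r"
      by (simp add: nth_cyc_on cyc_neq)
    with \<open>r < length b\<close> show "r \<in> ?M"
      by (auto simp: orbit_triangle_def)
  qed
  show "?M \<subseteq> S"
  proof
    fix r assume "r \<in> ?M"
    then show "r \<in> S"
      by (cases "r \<in> S") (auto simp: orbit_triangle_def nth_cyc_on)
  qed
qed

lemma orbit_triangle_determines_positions:
  assumes "orbit_triangle b S = orbit_triangle c R" "S \<subseteq> supp b" "R \<subseteq> supp c"
  shows "S = R"
proof -
  have "b \<in> orbit_triangle c R"
    unfolding assms(1)[symmetric] by (simp add: orbit_triangle_def)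
  then have "length b = length c"
    by (auto simp: orbit_triangle_def)
  then show ?thesis
    using moved_positions_orbit[OF assms(2)] moved_positions_orbit[OF assms(3)]
    unfolding assms(1) by simp
qed

lemma product_centered_full_triangles_eq:
  assumes "d1 > 0"
  shows "{T \<in> local_triangles n. T \<subseteq> full_words n \<and> product_centered d1 T}
     = (\<Union>S\<in>evenly_preceded n - {{}}. (\<lambda>b. orbit_triangle b S) ` full_words n)" (is "?L = ?R")
proof
  have iff: "product_centered d1 (orbit_triangle b S) \<longleftrightarrow> S \<in> evenly_preceded n"
    if "b \<in> full_words n" "S \<noteq> {}" "S \<subseteq> supp b" for b S
    using product_centered_orbit_iff[OF assms that(2,3)] that
    by (auto simp: full_words_eq_supp evenly_preceded_def)
  show "?L \<subseteq> ?R"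
  proof
    fix T assume "T \<in> ?L"
    then obtain b S where T: "T = orbit_triangle b S" and S: "S \<noteq> {}" "S \<subseteq> supp b"
      and "orbit_triangle b S \<subseteq> full_words n" "product_centered d1 (orbit_triangle b S)"
      by (auto simp: local_triangles_def)
    then have "b \<in> full_words n" "S \<in> evenly_preceded n"
      using orbit_triangle_full_words_iff iff by blast+
    with T S show "T \<in> ?R"
      by blast
  qed
  show "?R \<subseteq> ?L"
  proof
    fix T assume "T \<in> ?R"
    then obtain b S where T: "T = orbit_triangle b S" and b: "b \<in> full_words n"
      and S: "S \<noteq> {}" "S \<in> evenly_preceded n"
      by blast
    have "S \<subseteq> supp b" "b \<in> words n"
      using b S by (auto simp: full_words_eq_supp evenly_preceded_def words_def)
    moreover from this have "product_centered d1 T"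
      using iff b S by (simp add: T)
    ultimately show "T \<in> ?L"
      using b S orbit_triangle_full_words_iff by (auto simp: local_triangles_def T)
  qed
qed

theorem proposition8p2:
  fixes d1 :: real and n :: nat
  assumes "d1 > 0" and "n \<ge> 1"
  shows "card {T \<in> local_triangles n. T \<subseteq> full_words n \<and> product_centered d1 T}
       = (fib (n + 2) - 1) * 3 ^ (n - 1)"
proof -
  let ?I = "evenly_preceded n - {{}}"
  let ?C = "\<lambda>S. (\<lambda>b. orbit_triangle b S) ` full_words n"
  have fin: "finite (full_words n)"
    using card_full_words[of n] by (intro card_ge_0_finite) simp
  have below: "S \<subseteq> {..<n}" if "S \<in> ?I" for S
    using that by (simp add: evenly_preceded_def)
  have "card (\<Union>S\<in>?I. ?C S) = (\<Sum>S\<in>?I. card (?C S))"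
  proof (rule card_UN_disjoint)
    show "\<forall>S\<in>?I. \<forall>R\<in>?I. S \<noteq> R \<longrightarrow> ?C S \<inter> ?C R = {}"
    proof (intro ballI impI equals0I)
      fix S R T
      assume "S \<in> ?I" "R \<in> ?I" "S \<noteq> R" and "T \<in> ?C S \<inter> ?C R"
      then obtain b c where "orbit_triangle b S = orbit_triangle c R"
        "b \<in> full_words n" "c \<in> full_words n"
        by auto
      moreover from this have "S \<subseteq> supp b" "R \<subseteq> supp c"
        using below[OF \<open>S \<in> ?I\<close>] below[OF \<open>R \<in> ?I\<close>] by (simp_all add: full_words_eq_supp)
      ultimately show False
        using orbit_triangle_determines_positions \<open>S \<noteq> R\<close> by blast
    qed
  qed (use fin finite_evenly_preceded in auto)
  also have "\<dots> = (\<Sum>S\<in>?I. 3 ^ (n - 1))"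
    using below by (intro sum.cong) (simp_all add: card_orbit_triangles)
  also have "\<dots> = card ?I * 3 ^ (n - 1)"
    by simp
  also have "card ?I = fib (n + 2) - 1"
  proof -
    have "{} \<in> evenly_preceded n"
      by (simp add: evenly_preceded_def)
    then show ?thesis
      by (simp only: card_Diff_singleton card_evenly_preceded)
  qed
  finally show ?thesis
    by (simp only: product_centered_full_triangles_eq[OF assms(1)])
qed

end
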